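(* Every dyadic triangle in the dyadic plane $\mathbb{D}^2$ is isomorphic to a representative hat; that is, for every dyadic triangle $T\subset\mathbb{D}^2$ there exist an odd integer $i$ and positive odd integers $j,m$ such that $T$ is isomorphic to the dyadic triangle $T_{i,j,m}$ with vertices $(0,0)$, $(i,j)$ and $(m,0)$.
   Context: $\mathbb{D}=\mathbb{Z}[1/2]$ is the ring of dyadic rationals. A dyadic triangle is the intersection with $\mathbb{D}^2$ of a non-degenerate closed real triangle in $\mathbb{R}^2$ whose three vertices lie in $\mathbb{D}^2$. It is regarded as an algebra (groupoid) under the operation $x\circ y=\tfrac12(x+y)$. An isomorphism of dyadic triangles is a bijection preserving $\circ$; such isomorphisms are taken to be the restrictions of automorphisms of the affine $\mathbb{D}$-space $\mathbb{D}^2$, i.e. of maps $x\mapsto xM+t$ (row vectors) with $M\in \mathrm{GL}(2,\mathbb{D})$ (so $\det M=\pm2^k$ for some $k\in\mathbb{Z}$) and $t\in\mathbb{D}^2$. For an integer $i$ and positive integers $j,m$, $T_{i,j,m,0}$ denotes the dyadic triangle with vertices $(0,0)$, $(i,j)$, $(m,0)$. When $i,j,m$ are all odd, it is called a representative hat and is denoted $T_{i,j,m}$ (here $i$ may be any odd integer, possibly negative or larger than $m$). *)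

theory Defs
  imports "HOL-Analysis.Analysis"
begin

definition dyadic :: "real set" where
  "dyadic = {real_of_int a / 2 ^ n | a n. True}"

definition dyadic_plane :: "(real ^ 2) set" where
  "dyadic_plane = {x. \<forall>k. x $ k \<in> dyadic}"

definition dyadic_hull3 :: "real ^ 2 \<Rightarrow> real ^ 2 \<Rightarrow> real ^ 2 \<Rightarrow> (real ^ 2) set" where
  "dyadic_hull3 a b c = convex hull {a, b, c} \<inter> dyadic_plane"

definition dyadic_triangle :: "(real ^ 2) set \<Rightarrow> bool" where
  "dyadic_triangle T \<longleftrightarrow>
     (\<exists>a\<in>dyadic_plane. \<exists>b\<in>dyadic_plane. \<exists>c\<in>dyadic_plane.
        \<not> collinear {a, b, c} \<and> T = dyadic_hull3 a b c)"

definition dyadic_matrix :: "real ^ 2 ^ 2 \<Rightarrow> bool" where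
  "dyadic_matrix M \<longleftrightarrow> (\<forall>k l. M $ k $ l \<in> dyadic)"

definition GL2_dyadic :: "(real ^ 2 ^ 2) set" where
  "GL2_dyadic =
     {M. dyadic_matrix M \<and> (\<exists>N. dyadic_matrix N \<and> M ** N = mat 1 \<and> N ** M = mat 1)}"

text \<open>
  The groupoid operation is \<^const>\<open>midpoint\<close>. An isomorphism is a midpoint-preserving bijection
  that is moreover the restriction of an affine automorphism of the dyadic plane, acting on row
  vectors.
\<close>

definition dyadic_iso :: "(real ^ 2 \<Rightarrow> real ^ 2) \<Rightarrow> (real ^ 2) set \<Rightarrow> (real ^ 2) set \<Rightarrow> bool" where
  "dyadic_iso f S T \<longleftrightarrow>
     bij_betw f S T \<and>
     (\<forall>x\<in>S. \<forall>y\<in>S. f (midpoint x y) = midpoint (f x) (f y)) \<and>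
     (\<exists>M\<in>GL2_dyadic. \<exists>t\<in>dyadic_plane. \<forall>x\<in>S. f x = x v* M + t)"

definition dyadic_isomorphic :: "(real ^ 2) set \<Rightarrow> (real ^ 2) set \<Rightarrow> bool" where
  "dyadic_isomorphic S T \<longleftrightarrow> (\<exists>f. dyadic_iso f S T)"

text \<open>The triangle $T_{i,j,m,0}$, meaningful for positive \<open>j\<close> and \<open>m\<close>.\<close>

definition pointed_triangle :: "int \<Rightarrow> int \<Rightarrow> int \<Rightarrow> (real ^ 2) set" where
  "pointed_triangle i j m =
     dyadic_hull3 0 (vector [real_of_int i, real_of_int j]) (vector [real_of_int m, 0])"

definition representative_hat :: "int \<Rightarrow> int \<Rightarrow> int \<Rightarrow> bool" where
  "representative_hat i j m \<longleftrightarrow> odd i \<and> odd j \<and> odd m \<and> 0 < j \<and> 0 < m"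

end

theory Submission
  imports Defs
begin

text \<open>
  Move a vertex of the triangle to the origin and let \<open>u\<close>, \<open>v\<close> be the two remaining vertices. As
  the dyadic rationals form a principal ideal domain, some unimodular matrix sends \<open>v\<close> to
  \<open>(g, 0)\<close>. Every nonzero dyadic number is a unit times a positive odd integer, so scaling the two
  coordinates makes \<open>g\<close> and the second coordinate \<open>j\<close> of the image of \<open>u\<close> positive and odd. Since 2
  is invertible modulo the odd number \<open>j\<close>, every dyadic number is congruent modulo \<open>j\<close> to an odd
  integer, and a shear along the first axis finishes the normalisation.
\<close>

section \<open>Arithmetic of the ring of dyadic rationals\<close>

lemma dyadic_of_int [simp, intro]: "real_of_int a \<in> dyadic"
  unfolding dyadic_def by (rule CollectI, rule exI[of _ a], rule exI[of _ 0]) simp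

lemma dyadic_0 [simp, intro]: "0 \<in> dyadic" and dyadic_1 [simp, intro]: "1 \<in> dyadic"
  using dyadic_of_int[of 0] dyadic_of_int[of 1] by simp_all

lemma dyadic_divide_power2 [simp, intro]: "real_of_int a / 2 ^ n \<in> dyadic"
  unfolding dyadic_def by blast

lemma dyadic_mult [simp, intro]:
  assumes "x \<in> dyadic" "y \<in> dyadic"
  shows "x * y \<in> dyadic"
proof -
  obtain a n b k where "x = real_of_int a / 2 ^ n" "y = real_of_int b / 2 ^ k"
    using assms unfolding dyadic_def by blast
  then have "x * y = real_of_int (a * b) / 2 ^ (n + k)"
    by (simp add: power_add)
  then show ?thesis by (simp only: dyadic_divide_power2)
qed

lemma dyadic_uminus [simp, intro]: "x \<in> dyadic \<Longrightarrow> - x \<in> dyadic"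
  using dyadic_mult[OF dyadic_of_int[of "- 1"], of x] by simp

lemma dyadic_common_denominator:
  assumes "x \<in> dyadic" "y \<in> dyadic"
  obtains a b n where "x = real_of_int a / 2 ^ n" "y = real_of_int b / 2 ^ n"
proof -
  obtain a n b k where "x = real_of_int a / 2 ^ n" "y = real_of_int b / 2 ^ k"
    using assms unfolding dyadic_def by blast
  then have "x = real_of_int (a * 2 ^ k) / 2 ^ (n + k)" "y = real_of_int (b * 2 ^ n) / 2 ^ (n + k)"
    by (simp_all add: power_add)
  then show ?thesis by (rule that)
qed

lemma dyadic_add [simp, intro]:
  assumes "x \<in> dyadic" "y \<in> dyadic"
  shows "x + y \<in> dyadic"
proof -
  obtain a b n where "x = real_of_int a / 2 ^ n" "y = real_of_int b / 2 ^ n"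
    using dyadic_common_denominator[OF assms] .
  then have "x + y = real_of_int (a + b) / 2 ^ n"
    by (simp add: add_divide_distrib)
  then show ?thesis by (simp only: dyadic_divide_power2)
qed

lemma dyadic_diff [simp, intro]: "x \<in> dyadic \<Longrightarrow> y \<in> dyadic \<Longrightarrow> x - y \<in> dyadic"
  using dyadic_add[of x "- y"] by simp

text \<open>Over a common denominator this is Bezout's identity for integers: \<open>g\<close> is
  the integer gcd divided by that denominator. The coefficients \<open>s\<close> and
  \<open>t\<close> are what completes \<open>(p, q)\<close> to a matrix of determinant 1.\<close>

lemma dyadic_bezout:
  assumes "x \<in> dyadic" "y \<in> dyadic" "x \<noteq> 0 \<or> y \<noteq> 0"
  obtains g p q s t where "g \<in> dyadic" "g \<noteq> 0" "p \<in> dyadic" "q \<in> dyadic" "s \<in> dyadic" "t \<in> dyadic"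
    "x = g * p" "y = g * q" "p * s + q * t = 1"
proof -
  obtain a b n where ab: "x = real_of_int a / 2 ^ n" "y = real_of_int b / 2 ^ n"
    using dyadic_common_denominator[OF assms(1,2)] .
  define d where "d = gcd a b"
  have "d \<noteq> 0" using assms(3) ab unfolding d_def by auto
  obtain p q where pq: "a = d * p" "b = d * q"
    unfolding d_def by (meson dvdE gcd_dvd1 gcd_dvd2)
  obtain s t where "s * a + t * b = d"
    unfolding d_def using bezout_int by blast
  then have "d * (p * s + q * t) = d * 1"
    unfolding pq by (simp add: algebra_simps)
  then have "p * s + q * t = 1"
    using \<open>d \<noteq> 0\<close> by (simp only: mult_cancel_left) simp
  then have "real_of_int p * real_of_int s + real_of_int q * real_of_int t = 1"
    by (metis of_int_1 of_int_add of_int_mult)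
  then show ?thesis
    using that[of "real_of_int d / 2 ^ n" p q s t] ab pq \<open>d \<noteq> 0\<close> by simp
qed

lemma int_odd_part:
  assumes "a \<noteq> (0::int)"
  shows "\<exists>k b. a = 2 ^ k * b \<and> odd b"
  using assms
proof (induction "nat \<bar>a\<bar>" arbitrary: a rule: less_induct)
  case less
  show ?case
  proof (cases "odd a")
    case True
    then have "a = 2 ^ 0 * a \<and> odd a" by simp
    then show ?thesis by blast
  next
    case False
    then obtain c where c: "a = 2 * c" by blast
    have "nat \<bar>c\<bar> < nat \<bar>a\<bar>" "c \<noteq> 0" using c less.prems by auto
    then obtain k b where "c = 2 ^ k * b" "odd b"
      using less.hyps[of c] by blast
    then have "a = 2 ^ Suc k * b \<and> odd b" using c by simp
    then show ?thesis by blast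
  qed
qed

text \<open>The powers of 2 and their negatives are units, so \<open>w\<close> can absorb the sign
  and the 2-part of \<open>x\<close>. The inverse \<open>w'\<close> is carried along as a witness
  that \<open>w\<close> is a unit.\<close>

lemma dyadic_associated_odd:
  assumes "x \<in> dyadic" "x \<noteq> 0"
  obtains w w' m where "w \<in> dyadic" "w' \<in> dyadic" "w * w' = 1" "odd m" "0 < m" "x * w = real_of_int m"
proof -
  obtain a n where a: "x = real_of_int a / 2 ^ n"
    using assms(1) unfolding dyadic_def by blast
  obtain k b where b: "a = 2 ^ k * b" "odd b"
    using int_odd_part[of a] a assms(2) by auto
  have "b \<noteq> 0" using b(2) by auto
  define w where "w = real_of_int (sgn b * 2 ^ n) / 2 ^ k"
  define w' where "w' = real_of_int (sgn b * 2 ^ k) / 2 ^ n"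
  have "w * w' = 1"
    using \<open>b \<noteq> 0\<close> by (cases "b > 0") (auto simp: w_def w'_def)
  moreover have "x * w = real_of_int \<bar>b\<bar>"
    using \<open>b \<noteq> 0\<close> by (cases "b > 0") (auto simp: w_def a b)
  ultimately show ?thesis
    using that[of w w' "\<bar>b\<bar>"] b(2) \<open>b \<noteq> 0\<close> unfolding w_def w'_def
    by (simp only: dyadic_divide_power2) simp
qed

lemma dyadic_cong_odd:
  assumes "x \<in> dyadic" "odd j"
  obtains r i where "r \<in> dyadic" "odd i" "x + r * real_of_int j = real_of_int i"
proof -
  obtain a n where a: "x = real_of_int a / 2 ^ n"
    using assms(1) unfolding dyadic_def by blast
  have "coprime (2 ^ n) j" using assms(2) by simp
  then obtain s t where "s * 2 ^ n + t * j = 1"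
    using bezout_int[of "2 ^ n" j] by auto
  then have "real_of_int s * 2 ^ n + real_of_int t * real_of_int j = 1"
    by (metis of_int_1 of_int_add of_int_mult of_int_numeral of_int_power)
  then have "x * (real_of_int s * 2 ^ n + real_of_int t * real_of_int j) = x" by simp
  \<comment> \<open>As \<open>s\<close> inverts \<open>2 ^ n\<close> modulo \<open>j\<close>, the
    fraction \<open>a / 2 ^ n\<close> is congruent to the integer \<open>a * s\<close>.\<close>
  then have eq: "x + real_of_int (- a * t) / 2 ^ n * real_of_int j = real_of_int (a * s)"
    unfolding a by (simp add: field_simps)
  show ?thesis
  proof (cases "odd (a * s)")
    case True
    then show ?thesis using that eq by (meson dyadic_divide_power2)
  next
    case False
    \<comment> \<open>One more summand \<open>j\<close>, which is odd, corrects the parity.\<close>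
    have "x + (real_of_int (- a * t) / 2 ^ n + 1) * real_of_int j = real_of_int (a * s + j)"
      using eq by (simp add: algebra_simps)
    moreover have "odd (a * s + j)" using False assms(2) by simp
    ultimately show ?thesis using that by (meson dyadic_add dyadic_1 dyadic_divide_power2)
  qed
qed

section \<open>Matrices and affine automorphisms of the dyadic plane\<close>

lemma vector_matrix_mult_2:
  fixes M :: "real ^ 2 ^ 2"
  shows "x v* M = vector [x $ 1 * M $ 1 $ 1 + x $ 2 * M $ 2 $ 1, x $ 1 * M $ 1 $ 2 + x $ 2 * M $ 2 $ 2]"
  by (simp add: vec_eq_iff forall_2 vector_matrix_mult_def sum_2)

lemma GL2_dyadicI:
  assumes "dyadic_matrix M" "e \<in> dyadic" "det M * e = 1"
  shows "M \<in> GL2_dyadic"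
proof -
  \<comment> \<open>The adjugate of \<open>M\<close> divided by its determinant, whose inverse is
    \<open>e\<close>; hence all entries stay dyadic.\<close>
  define N :: "real ^ 2 ^ 2" where
    "N = vector [vector [M $ 2 $ 2 * e, - (M $ 1 $ 2 * e)], vector [- (M $ 2 $ 1 * e), M $ 1 $ 1 * e]]"
  have "dyadic_matrix N"
    using assms(1,2) unfolding dyadic_matrix_def N_def by (auto simp: forall_2)
  moreover have "M ** N = mat 1" "N ** M = mat 1"
    using assms(3) unfolding N_def
    by (simp_all add: vec_eq_iff forall_2 matrix_matrix_mult_def sum_2 mat_def det_2 algebra_simps)
  ultimately show ?thesis
    using assms(1) unfolding GL2_dyadic_def by blast
qed

lemma collinear_0_2:
  fixes u v :: "real ^ 2"
  assumes "u $ 1 * v $ 2 = u $ 2 * v $ 1"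
  shows "collinear {0, u, v}"
proof (cases "u = 0")
  case False
  then consider "u $ 1 \<noteq> 0" | "u $ 2 \<noteq> 0"
    by (auto simp: vec_eq_iff forall_2)
  then show ?thesis
  proof cases
    case 1
    then have "v = (v $ 1 / u $ 1) *\<^sub>R u"
      using assms by (simp add: vec_eq_iff forall_2 field_simps)
    then show ?thesis unfolding collinear_lemma by blast
  next
    case 2
    then have "v = (v $ 2 / u $ 2) *\<^sub>R u"
      using assms by (simp add: vec_eq_iff forall_2 field_simps)
    then show ?thesis unfolding collinear_lemma by blast
  qed
qed (simp add: collinear_lemma)

lemma dyadic_plane_vector_matrix_mult:
  assumes "x \<in> dyadic_plane" "dyadic_matrix M"
  shows "x v* M \<in> dyadic_plane"
  using assms unfolding dyadic_plane_def dyadic_matrix_def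
  by (simp add: vector_matrix_mult_def sum_2)

text \<open>Affine maps commute with convex hulls, and an affine map that is invertible over the
  dyadic rationals both preserves and reflects membership in the plane, so it also respects the
  intersection. The translation is chosen to send \<open>a\<close> to the origin.\<close>

lemma dyadic_isomorphic_hull3:
  assumes M: "M \<in> GL2_dyadic" and a: "a \<in> dyadic_plane"
  shows "dyadic_isomorphic (dyadic_hull3 a b c) (dyadic_hull3 0 ((b - a) v* M) ((c - a) v* M))"
proof -
  obtain N where dM: "dyadic_matrix M" and dN: "dyadic_matrix N"
    and MN: "M ** N = mat 1" "N ** M = mat 1"
    using M unfolding GL2_dyadic_def by blast
  define t where "t = - (a v* M)"
  define f where "f x = x v* M + t" for x
  \<comment> \<open>The inverse of \<open>f\<close>; its dyadic coefficients give the reflecting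
    direction of \<open>plane\<close>.\<close>
  define h where "h y = y v* N + a" for y
  have t: "t \<in> dyadic_plane"
    using dyadic_plane_vector_matrix_mult[OF a dM] by (simp add: t_def dyadic_plane_def)
  have hf: "h (f x) = x" and fh: "f (h x) = x" for x
    by (simp_all add: f_def h_def t_def vector_matrix_left_distrib vector_matrix_mult_diff_distrib
        vector_matrix_mul_assoc MN flip: diff_conv_add_uminus)
  have lin: "linear (\<lambda>x. x v* M)"
    using matrix_vector_mul_linear[of "transpose M"] by simp
  have plane: "f x \<in> dyadic_plane \<longleftrightarrow> x \<in> dyadic_plane" for x
  proof
    have *: "y \<in> dyadic_plane \<Longrightarrow> h y \<in> dyadic_plane" for y
      using dyadic_plane_vector_matrix_mult[OF _ dN] a by (auto simp: h_def dyadic_plane_def)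
    show "x \<in> dyadic_plane" if "f x \<in> dyadic_plane"
      using *[OF that] by (simp add: hf)
    show "f x \<in> dyadic_plane" if "x \<in> dyadic_plane"
      using dyadic_plane_vector_matrix_mult[OF that dM] t by (auto simp: f_def dyadic_plane_def)
  qed
  have "f ` (convex hull {a, b, c}) = (\<lambda>x. t + x) ` (\<lambda>x. x v* M) ` (convex hull {a, b, c})"
    by (auto simp: f_def image_image add.commute)
  also have "\<dots> = convex hull (\<lambda>x. t + x) ` (\<lambda>x. x v* M) ` {a, b, c}"
    by (simp only: convex_hull_linear_image[OF lin] convex_hull_translation)
  also have "(\<lambda>x. t + x) ` (\<lambda>x. x v* M) ` {a, b, c} = {0, (b - a) v* M, (c - a) v* M}"
    by (simp add: t_def vector_matrix_mult_diff_distrib)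
  finally have hull: "f ` (convex hull {a, b, c}) = convex hull {0, (b - a) v* M, (c - a) v* M}" .
  have "f ` dyadic_hull3 a b c = f ` (convex hull {a, b, c}) \<inter> dyadic_plane"
    unfolding dyadic_hull3_def using plane by blast
  then have "f ` dyadic_hull3 a b c = dyadic_hull3 0 ((b - a) v* M) ((c - a) v* M)"
    unfolding dyadic_hull3_def hull .
  moreover have "inj f" using hf by (metis injI)
  ultimately have "bij_betw f (dyadic_hull3 a b c) (dyadic_hull3 0 ((b - a) v* M) ((c - a) v* M))"
    by (auto simp: bij_betw_def intro: inj_on_subset)
  moreover have "f (midpoint x y) = midpoint (f x) (f y)" for x y
    unfolding f_def midpoint_linear_image[OF lin, symmetric]
    by (simp add: midpoint_def vec_eq_iff field_simps)
  ultimately show ?thesis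
    unfolding dyadic_isomorphic_def dyadic_iso_def using M t f_def by blast
qed

section \<open>Normal form of a triangle with a vertex at the origin\<close>

lemma GL2_dyadic_normal_form:
  assumes "u \<in> dyadic_plane" "v \<in> dyadic_plane" "\<not> collinear {0, u, v}"
  obtains M i j m where "M \<in> GL2_dyadic" "representative_hat i j m"
    "u v* M = vector [real_of_int i, real_of_int j]" "v v* M = vector [real_of_int m, 0]"
proof -
  have det0: "u $ 1 * v $ 2 \<noteq> u $ 2 * v $ 1"
    using assms(3) collinear_0_2 by blast
  have dy: "u $ k \<in> dyadic" "v $ k \<in> dyadic" for k
    using assms(1,2) by (auto simp: dyadic_plane_def)
  have "v $ 1 \<noteq> 0 \<or> v $ 2 \<noteq> 0" using det0 by auto
  then obtain g p q s t where g: "g \<in> dyadic" "g \<noteq> 0"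
    and pq: "p \<in> dyadic" "q \<in> dyadic" and st: "s \<in> dyadic" "t \<in> dyadic"
    and v: "v $ 1 = g * p" "v $ 2 = g * q" and bez: "p * s + q * t = 1"
    using dyadic_bezout[OF dy(2) dy(2)] by metis
  obtain w w' m where w: "w \<in> dyadic" "w' \<in> dyadic" "w * w' = 1"
    and m: "odd m" "0 < m" "g * w = real_of_int m"
    using dyadic_associated_odd[OF g] .
  \<comment> \<open>The matrix with rows \<open>(s, -q)\<close> and \<open>(t, p)\<close> sends
    \<open>v\<close> to \<open>(g, 0)\<close> and gives \<open>u\<close> this second coordinate. Its
    product with \<open>g\<close> is the determinant of \<open>v\<close> and \<open>u\<close>, hence
    it is nonzero.\<close>
  have "u $ 2 * p - u $ 1 * q \<in> dyadic" "u $ 2 * p - u $ 1 * q \<noteq> 0"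
    using dy pq det0 v by auto
  then obtain z z' j where z: "z \<in> dyadic" "z' \<in> dyadic" "z * z' = 1"
    and j: "odd j" "0 < j" "(u $ 2 * p - u $ 1 * q) * z = real_of_int j"
    by (rule dyadic_associated_odd)
  \<comment> \<open>The first coordinate of the image of \<open>u\<close> after scaling by
    \<open>w\<close>. The shear by \<open>r\<close> changes it modulo \<open>j\<close> and fixes the
    image of \<open>v\<close>, which lies on the first axis.\<close>
  have "(u $ 1 * s + u $ 2 * t) * w \<in> dyadic" using dy st w by auto
  then obtain r i where r: "r \<in> dyadic" and i: "odd i"
    "(u $ 1 * s + u $ 2 * t) * w + r * real_of_int j = real_of_int i"
    using j(1) by (rule dyadic_cong_odd)
  \<comment> \<open>The product, in this order, of the matrix with rows \<open>(s, -q)\<close>,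
    \<open>(t, p)\<close>, the diagonal matrix of \<open>w\<close>, \<open>z\<close>, and the shear
    with rows \<open>(1, 0)\<close>, \<open>(r, 1)\<close>. Its determinant is therefore
    \<open>w * z\<close>.\<close>
  define M :: "real ^ 2 ^ 2" where
    "M = vector [vector [s * w - r * q * z, - (q * z)], vector [t * w + r * p * z, p * z]]"
  have "dyadic_matrix M"
    using pq st w z r unfolding dyadic_matrix_def M_def by (auto simp: forall_2)
  moreover have "det M * (w' * z') = (p * s + q * t) * (w * w') * (z * z')"
    unfolding M_def by (simp add: det_2 algebra_simps)
  then have "det M * (w' * z') = 1" using bez w z by simp
  ultimately have "M \<in> GL2_dyadic"
    using w(2) z(2) by (intro GL2_dyadicI[of M "w' * z'"]) auto
  moreover have "u v* M = vector [real_of_int i, real_of_int j]"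
    unfolding vector_matrix_mult_2 M_def i(2)[symmetric] j(3)[symmetric]
    by (simp add: algebra_simps)
  moreover have "v v* M = vector [g * w * (p * s + q * t), 0]"
    unfolding vector_matrix_mult_2 M_def v by (simp add: algebra_simps)
  then have "v v* M = vector [real_of_int m, 0]" using bez m by simp
  ultimately show ?thesis
    using that i(1) j(1,2) m(1,2) unfolding representative_hat_def by blast
qed

theorem theorem4p13:
  fixes T :: "(real ^ 2) set"
  assumes "dyadic_triangle T"
  shows "\<exists>i j m :: int. representative_hat i j m \<and> dyadic_isomorphic T (pointed_triangle i j m)"
proof -
  obtain a b c where abc: "a \<in> dyadic_plane" "b \<in> dyadic_plane" "c \<in> dyadic_plane"
    and nc: "\<not> collinear {a, b, c}" and T: "T = dyadic_hull3 a b c"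
    using assms unfolding dyadic_triangle_def by blast
  \<comment> \<open>\<open>collinear_3\<close> subtracts its middle point, so \<open>a\<close> is
    put in the middle.\<close>
  have "\<not> collinear {0, b - a, c - a}"
    using nc collinear_3[of b a c] by (simp add: insert_commute)
  moreover have "b - a \<in> dyadic_plane" "c - a \<in> dyadic_plane"
    using abc by (auto simp: dyadic_plane_def)
  ultimately obtain M i j m where "M \<in> GL2_dyadic" "representative_hat i j m"
    "(b - a) v* M = vector [real_of_int i, real_of_int j]" "(c - a) v* M = vector [real_of_int m, 0]"
    using GL2_dyadic_normal_form by blast
  then show ?thesis
    using dyadic_isomorphic_hull3[of M a b c] abc(1) unfolding T pointed_triangle_def by metis
qed

end
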